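(* Let $k,i\in\mathbb{N}$ with $1\le i\le k/2$. Then there exists a family of $k$-uniform hypergraph properties $f_v$ on $v$ vertices such that $s(f_v)=\Theta(v^{k-i})$ and $bs(f_v)=\Theta(v^k)$.
   Context: A $k$-uniform hypergraph on $[v]$ is identified with a string in $\{0,1\}^{\binom vk}$. A $k$-uniform hypergraph property is a Boolean function on such strings invariant under all permutations of $[v]$. For $B$ a set of coordinates, $x^B$ is $x$ with the bits in $B$ flipped. $s(f)=\max_x|\{j: f(x^{\{j\}})\ne f(x)\}|$. $bs(f)=\max_x$ of the maximum number of pairwise disjoint sets $B$ with $f(x^B)\ne f(x)$. Asymptotics as $v\to\infty$ with $k,i$ fixed. *)

theory Defs
  imports Main "HOL-Library.Landau_Symbols" "HOL-Combinatorics.Permutations"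
begin

text \<open>Coordinates of a k-uniform hypergraph on vertex set [v] = {0..<v}: the k-subsets.
  A hypergraph (string in {0,1}^(v choose k)) is identified with its edge set,
  a subset of these coordinates.\<close>
definition coords :: "nat \<Rightarrow> nat \<Rightarrow> nat set set" where
  "coords v k = {S. S \<subseteq> {..<v} \<and> card S = k}"

definition hgraphs :: "nat \<Rightarrow> nat \<Rightarrow> nat set set set" where
  "hgraphs v k = Pow (coords v k)"

definition flip :: "nat set set \<Rightarrow> nat set set \<Rightarrow> nat set set" where
  "flip x B = (x - B) \<union> (B - x)"

definition is_property :: "nat \<Rightarrow> nat \<Rightarrow> (nat set set \<Rightarrow> bool) \<Rightarrow> bool" where
  "is_property v k f \<longleftrightarrow>
     (\<forall>\<pi>. \<pi> permutes {..<v} \<longrightarrow> (\<forall>x\<in>hgraphs v k. f ((\<lambda>S. \<pi> ` S) ` x) = f x))"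

definition sens :: "nat \<Rightarrow> nat \<Rightarrow> (nat set set \<Rightarrow> bool) \<Rightarrow> nat" where
  "sens v k f = Max {card {j \<in> coords v k. f (flip x {j}) \<noteq> f x} | x. x \<in> hgraphs v k}"

definition bsens :: "nat \<Rightarrow> nat \<Rightarrow> (nat set set \<Rightarrow> bool) \<Rightarrow> nat" where
  "bsens v k f = Max {card F | F x. x \<in> hgraphs v k \<and> F \<subseteq> Pow (coords v k) \<and>
       (\<forall>B\<in>F. \<forall>C\<in>F. B \<noteq> C \<longrightarrow> B \<inter> C = {}) \<and>
       (\<forall>B\<in>F. f (flip x B) \<noteq> f x)}"

end

theory Submission
  imports Defs
begin

text \<open>
  Let \<open>f x\<close> hold iff \<open>x\<close> contains a complete hypergraph on some set \<open>W\<close> of \<open>k + 3\<close>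
  vertices and no other edge of \<open>x\<close> meets \<open>W\<close> in at least \<open>i\<close> vertices.
  If \<open>f x\<close> holds with witness \<open>W\<close>, only the \<open>O(v\<^sup>k\<^sup>-\<^sup>i)\<close> edges meeting \<open>W\<close> in at least \<open>i\<close>
  vertices can be sensitive. If \<open>f x\<close> fails, a sensitive edge is determined by the witness that its
  flip creates, and two different such witnesses share fewer than \<open>i\<close> vertices, since otherwise the
  two flips of \<open>x\<close> would differ in three edges; so there are at most \<open>O(v\<^sup>i)\<close> sensitive edges, and
  \<open>i \<le> k - i\<close>. For the block sensitivity, a maximal packing of \<open>(k + 3)\<close>-sets pairwise
  sharing fewer than \<open>k\<close> vertices gives \<open>\<Omega>(v\<^sup>k)\<close> edge-disjoint cliques, each of which is a sensitive
  block of the empty hypergraph.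
\<close>

section \<open>The isolated clique property and basic counting\<close>

text \<open>Besides edge sets of complete hypergraphs, this also provides the plain
  \<open>i\<close>-subsets of a vertex set in the counting arguments.\<close>

definition clique :: "nat \<Rightarrow> 'a set \<Rightarrow> 'a set set" where
  "clique k W = {e. e \<subseteq> W \<and> card e = k}"

text \<open>A \<open>k\<close>-set inside \<open>W\<close> meets it in \<open>k\<close> vertices, so
  for \<open>i \<le> k\<close> a single equivalence encodes both completeness on \<open>W\<close>
  and the absence of other edges with \<open>i\<close> or more vertices in \<open>W\<close>.\<close>

definition isolated_clique :: "nat \<Rightarrow> nat \<Rightarrow> nat \<Rightarrow> nat set \<Rightarrow> nat set set \<Rightarrow> bool" where
  "isolated_clique v k i W x \<longleftrightarrow> (\<forall>e\<in>coords v k. i \<le> card (e \<inter> W) \<longrightarrow> (e \<in> x \<longleftrightarrow> e \<subseteq> W))"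

text \<open>The size \<open>k + 3\<close> leaves room for three edges of one witness that violate
  the isolation of another, one more than two single flips can account for.\<close>

definition has_isolated_clique :: "nat \<Rightarrow> nat \<Rightarrow> nat \<Rightarrow> nat set set \<Rightarrow> bool" where
  "has_isolated_clique v k i x \<longleftrightarrow> (\<exists>W\<in>coords v (k + 3). isolated_clique v k i W x)"

lemma finite_coords [simp]: "finite (coords v k)"
  unfolding coords_def by (rule finite_subset[of _ "Pow {..<v}"]) auto

lemma card_coords: "card (coords v k) = v choose k"
  unfolding coords_def using n_subsets[of "{..<v}" k] by simp

lemma finite_coordsD: "W \<in> coords v k \<Longrightarrow> finite W"
  unfolding coords_def using finite_subset by blast

lemma clique_subset_coords: "W \<in> coords v m \<Longrightarrow> clique k W \<subseteq> coords v k"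
  unfolding coords_def clique_def by blast

lemma finite_hgraphs [simp]: "finite (hgraphs v k)"
  unfolding hgraphs_def by simp

lemma mem_flip_singleton: "e \<in> flip x {j} \<longleftrightarrow> (e \<in> x) \<noteq> (e = j)"
  unfolding flip_def by auto

lemma exists_subset_card: "n \<le> card S \<Longrightarrow> \<exists>T\<subseteq>S. card T = n"
  by (metis obtain_subset_with_card_n)

lemma binomial_le_pow_nat: "n choose r \<le> n ^ r"
proof (cases "r \<le> n")
  case True
  then show ?thesis by (rule binomial_le_pow)
qed (simp add: binomial_eq_0)

section \<open>General bounds on sensitivity and block sensitivity\<close>

lemma card_le_sens:
  assumes "x \<in> hgraphs v k"
  shows "card {j \<in> coords v k. f (flip x {j}) \<noteq> f x} \<le> sens v k f"
  unfolding sens_def using assms by (intro Max_ge) (auto simp: setcompr_eq_image)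

lemma sens_leI:
  assumes "\<And>x. x \<in> hgraphs v k \<Longrightarrow> card {j \<in> coords v k. f (flip x {j}) \<noteq> f x} \<le> b"
  shows "sens v k f \<le> b"
proof -
  have "{} \<in> hgraphs v k"
    unfolding hgraphs_def by simp
  then show ?thesis
    unfolding sens_def using assms
    by (subst Max_le_iff) (auto simp: setcompr_eq_image)
qed

definition sensitive_blocks ::
  "nat \<Rightarrow> nat \<Rightarrow> (nat set set \<Rightarrow> bool) \<Rightarrow> nat set set \<Rightarrow> nat set set set \<Rightarrow> bool" where
  "sensitive_blocks v k f x F \<longleftrightarrow> x \<in> hgraphs v k \<and> F \<subseteq> Pow (coords v k) \<and>
     (\<forall>B\<in>F. \<forall>C\<in>F. B \<noteq> C \<longrightarrow> B \<inter> C = {}) \<and> (\<forall>B\<in>F. f (flip x B) \<noteq> f x)"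

lemma bsens_altdef: "bsens v k f = Max {card F | F x. sensitive_blocks v k f x F}"
  unfolding bsens_def sensitive_blocks_def by simp

lemma finite_card_sensitive_blocks: "finite {card F | F x. sensitive_blocks v k f x F}"
proof (rule finite_subset)
  show "{card F | F x. sensitive_blocks v k f x F} \<subseteq> card ` Pow (Pow (coords v k))"
    unfolding sensitive_blocks_def by blast
qed simp

lemma card_le_bsens: "sensitive_blocks v k f x F \<Longrightarrow> card F \<le> bsens v k f"
  unfolding bsens_altdef by (rule Max_ge[OF finite_card_sensitive_blocks]) blast

text \<open>A sensitive block is nonempty, since flipping nothing changes nothing. As the blocks are
  disjoint, choosing one coordinate from each is injective.\<close>

lemma card_sensitive_blocks_le:
  assumes "sensitive_blocks v k f x F"
  shows "card F \<le> v choose k"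
proof -
  have sub: "B \<subseteq> coords v k" and ne: "B \<noteq> {}" if "B \<in> F" for B
    using assms that unfolding sensitive_blocks_def flip_def by auto
  have some: "(SOME e. e \<in> B) \<in> B" if "B \<in> F" for B
    using ne[OF that] by (simp add: some_in_eq)
  have "inj_on (\<lambda>B. SOME e. e \<in> B) F"
  proof (rule inj_onI)
    fix B C assume BC: "B \<in> F" "C \<in> F" "(SOME e. e \<in> B) = (SOME e. e \<in> C)"
    then have "B \<inter> C \<noteq> {}"
      using some[of B] some[of C] by auto
    then show "B = C"
      using assms BC unfolding sensitive_blocks_def by blast
  qed
  then have "card F \<le> card (coords v k)"
    using sub some by (intro card_inj_on_le) auto
  then show ?thesis
    by (simp add: card_coords)
qed

lemma bsens_le: "bsens v k f \<le> v choose k"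
proof -
  have "sensitive_blocks v k f {} {}"
    unfolding sensitive_blocks_def hgraphs_def by simp
  then have "{card F | F x. sensitive_blocks v k f x F} \<noteq> {}"
    by blast
  then show ?thesis
    unfolding bsens_altdef using card_sensitive_blocks_le
    by (subst Max_le_iff[OF finite_card_sensitive_blocks]) blast+
qed

section \<open>Invariance under vertex permutations\<close>

lemma has_isolated_clique_permute:
  assumes \<pi>: "\<pi> permutes {..<v}" and x: "has_isolated_clique v k i x"
  shows "has_isolated_clique v k i ((`) \<pi> ` x)"
proof -
  obtain W where W: "W \<in> coords v (k + 3)" "isolated_clique v k i W x"
    using x unfolding has_isolated_clique_def by blast
  have inj: "inj \<pi>"
    using \<pi> by (rule permutes_inj)
  have "\<pi> ` W \<in> coords v (k + 3)"
    using W(1) permutes_image[OF \<pi>] inj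
    unfolding coords_def by (auto simp: card_image inj_on_subset)
  moreover have "isolated_clique v k i (\<pi> ` W) ((`) \<pi> ` x)"
    unfolding isolated_clique_def
  proof (intro ballI impI)
    fix e assume e: "e \<in> coords v k" "i \<le> card (e \<inter> \<pi> ` W)"
    define d where "d = inv \<pi> ` e"
    have ed: "e = \<pi> ` d"
      unfolding d_def using permutes_surj[OF \<pi>] by (simp add: image_f_inv_f)
    have "d \<subseteq> {..<v}"
      using e(1) permutes_image[OF permutes_inv[OF \<pi>]] unfolding d_def coords_def by blast
    moreover have "card d = k"
      using e(1) inj unfolding ed coords_def by (simp add: card_image inj_on_subset)
    moreover have "card (d \<inter> W) = card (e \<inter> \<pi> ` W)"
      unfolding ed using inj by (metis card_image image_Int inj_on_subset subset_UNIV)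
    ultimately have "d \<in> x \<longleftrightarrow> d \<subseteq> W"
      using W(2) e(2) unfolding isolated_clique_def coords_def by simp
    then show "e \<in> (`) \<pi> ` x \<longleftrightarrow> e \<subseteq> \<pi> ` W"
      unfolding ed using inj by (auto simp: inj_image_eq_iff inj_image_subset_iff)
  qed
  ultimately show ?thesis
    unfolding has_isolated_clique_def by blast
qed

text \<open>Preservation under \<open>\<pi>\<close> is one direction; preservation under
  \<open>inv \<pi>\<close> gives the other.\<close>

lemma is_property_has_isolated_clique: "is_property v k (has_isolated_clique v k i)"
  unfolding is_property_def
proof (intro allI impI ballI iffI)
  fix \<pi> x assume \<pi>: "\<pi> permutes {..<v}"
  show "has_isolated_clique v k i ((`) \<pi> ` x)" if "has_isolated_clique v k i x"
    using has_isolated_clique_permute[OF \<pi> that] .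
  assume "has_isolated_clique v k i ((`) \<pi> ` x)"
  then have "has_isolated_clique v k i ((`) (inv \<pi>) ` (`) \<pi> ` x)"
    by (rule has_isolated_clique_permute[OF permutes_inv[OF \<pi>]])
  moreover have "(`) (inv \<pi>) ` (`) \<pi> ` x = x"
    using permutes_inj[OF \<pi>] by (simp add: image_image image_inv_f_f)
  ultimately show "has_isolated_clique v k i x"
    by simp
qed

section \<open>Sensitivity\<close>

text \<open>Such an edge is the union of an \<open>i\<close>-subset of \<open>W\<close> and
  \<open>k - i\<close> further vertices.\<close>

lemma card_meeting_le:
  assumes "W \<in> coords v m" "i \<le> k"
  shows "card {j \<in> coords v k. i \<le> card (j \<inter> W)} \<le> (m choose i) * v ^ (k - i)"
proof -
  let ?D = "clique i W \<times> coords v (k - i)"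
  have fin: "finite (clique i W)"
    using clique_subset_coords[OF assms(1)] finite_coords finite_subset by blast
  have "{j \<in> coords v k. i \<le> card (j \<inter> W)} \<subseteq> (\<lambda>(a, b). a \<union> b) ` ?D"
  proof
    fix j assume j: "j \<in> {j \<in> coords v k. i \<le> card (j \<inter> W)}"
    then obtain a where a: "a \<subseteq> j \<inter> W" "card a = i"
      by (blast dest: exists_subset_card)
    have "finite j"
      using j finite_coordsD by blast
    then have "card (j - a) = k - i"
      using a j finite_subset[of a j] unfolding coords_def by (subst card_Diff_subset) auto
    then have "(a, j - a) \<in> ?D" "j = a \<union> (j - a)"
      using a j unfolding clique_def coords_def by auto
    then show "j \<in> (\<lambda>(a, b). a \<union> b) ` ?D"
      by (auto intro: image_eqI[of _ _ "(a, j - a)"])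
  qed
  then have "card {j \<in> coords v k. i \<le> card (j \<inter> W)} \<le> card ?D"
    using fin by (intro surj_card_le) auto
  also have "\<dots> = (m choose i) * (v choose (k - i))"
    using assms(1) n_subsets[OF finite_coordsD[OF assms(1)], of i]
    by (simp add: card_cartesian_product card_coords clique_def) (simp add: coords_def)
  also have "\<dots> \<le> (m choose i) * v ^ (k - i)"
    by (simp add: binomial_le_pow_nat)
  finally show ?thesis .
qed

text \<open>The three edges share a core \<open>T\<close> of size \<open>k - 1\<close> and differ in the remaining vertex.\<close>

lemma three_crossing_edges:
  assumes fin: "finite W" "finite W'" and cards: "card W = k + 3" "card W' = k + 3"
    and ne: "W \<noteq> W'" and i: "i \<le> card (W \<inter> W')" "i < k" and k: "2 \<le> k"
  shows "3 \<le> card {e \<in> clique k W'. \<not> e \<subseteq> W \<and> i \<le> card (e \<inter> W)}" (is "_ \<le> card ?E")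
proof -
  obtain T A where TA: "T \<subseteq> W'" "card T = k - 1" "A \<subseteq> W' - T" "card A = 3"
    "\<And>a. a \<in> A \<Longrightarrow> \<not> insert a T \<subseteq> W \<and> i \<le> card (insert a T \<inter> W)"
  \<comment> \<open>With three vertices of \<open>W'\<close> outside \<open>W\<close>, these vary
    and the core keeps \<open>i\<close> common vertices. Otherwise the sets share at least
    \<open>k + 1\<close> vertices; the core is then one vertex outside \<open>W\<close> with
    \<open>k - 2\<close> common ones, and three more common vertices vary.\<close>
  proof (cases "3 \<le> card (W' - W)")
    case True
    then obtain A where A: "A \<subseteq> W' - W" "card A = 3"
      by (blast dest: exists_subset_card)
    obtain I where I: "I \<subseteq> W \<inter> W'" "card I = i"
      using i(1) by (blast dest: exists_subset_card)
    \<comment> \<open>Since \<open>i \<le> k - 1\<close>, a core of size \<open>k - 1\<close>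
      containing \<open>I\<close> fits between \<open>I\<close> and these \<open>k\<close>
      vertices.\<close>
    have "card (W' - A) = k"
      using A fin cards by (subst card_Diff_subset) (auto intro: finite_subset)
    moreover have "I \<subseteq> W' - A"
      using I(1) A(1) by blast
    ultimately have "\<exists>T. I \<subseteq> T \<and> T \<subseteq> W' - A \<and> card T = k - 1"
      using I(2) i(2) fin(2) by (intro exists_subset_between) auto
    then obtain T where T: "I \<subseteq> T" "T \<subseteq> W' - A" "card T = k - 1"
      by blast
    have "i \<le> card (insert a T \<inter> W)" for a
      unfolding I(2)[symmetric] using I(1) T(1) fin by (intro card_mono) auto
    moreover have "\<not> insert a T \<subseteq> W" if "a \<in> A" for a
      using that A(1) by blast
    moreover have "T \<subseteq> W'" "A \<subseteq> W' - T"
      using A(1) T(2) by auto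
    ultimately show ?thesis
      using that[of T A] A(2) T(3) by simp
  next
    case False
    have split: "card (W' - W) + card (W \<inter> W') = k + 3"
      using card_Int_Diff[of W' W] fin cards by (simp add: Int_commute)
    have "\<not> W' \<subseteq> W"
      using ne cards fin card_subset_eq[of W W'] by auto
    then obtain u where u: "u \<in> W'" "u \<notin> W"
      by blast
    have "k - 2 \<le> card (W \<inter> W')"
      using split False by linarith
    then obtain T where T: "T \<subseteq> W \<inter> W'" "card T = k - 2"
      by (blast dest: exists_subset_card)
    have finT: "finite T"
      using T fin finite_subset by blast
    have "card (W \<inter> W' - T) = card (W \<inter> W') - (k - 2)"
      using T finT by (subst card_Diff_subset) auto
    then have "3 \<le> card (W \<inter> W' - T)"
      using split False k by linarith
    then obtain A where A: "A \<subseteq> W \<inter> W' - T" "card A = 3"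
      by (blast dest: exists_subset_card)
    have "card (insert u T) = k - 1"
      using u T finT k by (subst card_insert_disjoint) auto
    \<comment> \<open>Only \<open>u\<close> lies outside \<open>W\<close>, so the edge keeps
      \<open>k - 1\<close> vertices in \<open>W\<close>, which suffices because
      \<open>i < k\<close>.\<close>
    moreover have "i \<le> card (insert a (insert u T) \<inter> W)" if "a \<in> A" for a
    proof -
      have "insert a (insert u T) \<inter> W = insert a T"
        using that A T u by blast
      then show ?thesis
        using that A T finT i k by (auto simp: card_insert_if)
    qed
    moreover have "insert u T \<subseteq> W'" "A \<subseteq> W' - insert u T"
      using A(1) T(1) u by auto
    moreover have "\<not> insert a (insert u T) \<subseteq> W" for a
      using u(2) by blast
    ultimately show ?thesis
      using that[of "insert u T" A] A(2) by simp
  qed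
  have finT: "finite T"
    using TA fin finite_subset by blast
  have "(\<lambda>a. insert a T) ` A \<subseteq> ?E"
  proof
    fix e assume "e \<in> (\<lambda>a. insert a T) ` A"
    then obtain a where a: "a \<in> A" "e = insert a T"
      by blast
    then have "card e = k"
      using TA finT k by (auto simp: card_insert_if)
    then show "e \<in> ?E"
      using a TA unfolding clique_def by blast
  qed
  moreover have "inj_on (\<lambda>a. insert a T) A"
    using TA(3) by (intro inj_onI) blast
  moreover have "finite ?E"
    using fin by (intro finite_subset[of ?E "Pow W'"]) (auto simp: clique_def)
  ultimately have "card A \<le> card ?E"
    by (intro card_inj_on_le)
  then show ?thesis
    using TA(4) by simp
qed

text \<open>A crossing edge is forced to be present by \<open>W'\<close> and absent by
  \<open>W\<close>, so the two flips disagree on it. They can disagree only on \<open>j\<close> and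
  \<open>l\<close>, but a large overlap yields three crossing edges.\<close>

lemma flip_witnesses_overlap:
  assumes W: "W \<in> coords v (k + 3)" "isolated_clique v k i W (flip x {j})"
    and W': "W' \<in> coords v (k + 3)" "isolated_clique v k i W' (flip x {l})"
    and ne: "W \<noteq> W'" and i: "i < k" and k: "2 \<le> k"
  shows "card (W \<inter> W') < i"
proof (rule ccontr)
  let ?E = "{e \<in> clique k W'. \<not> e \<subseteq> W \<and> i \<le> card (e \<inter> W)}"
  assume "\<not> card (W \<inter> W') < i"
  then have "3 \<le> card ?E"
    using W W' ne i k by (intro three_crossing_edges) (auto simp: finite_coordsD, auto simp: coords_def)
  moreover have "?E \<subseteq> {j, l}"
  proof
    fix e assume e: "e \<in> ?E"
    then have "e \<in> coords v k"
      using clique_subset_coords[OF W'(1)] by blast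
    moreover have "e \<inter> W' = e" "card e = k" "e \<subseteq> W'"
      using e unfolding clique_def by auto
    ultimately have "e \<in> flip x {l}" "e \<notin> flip x {j}"
      using W(2) W'(2) e i unfolding isolated_clique_def by auto
    then show "e \<in> {j, l}"
      unfolding mem_flip_singleton by blast
  qed
  then have "card ?E \<le> card {j, l}"
    by (intro card_mono) auto
  moreover have "card {j, l} \<le> 2"
    by (simp add: card_insert_if)
  ultimately show False
    by linarith
qed

text \<open>The isolation of \<open>W\<close> inspects only edges with at least \<open>i\<close>
  vertices in \<open>W\<close>. Hence a flip that destroys or creates the witness \<open>W\<close>
  must be at such an edge.\<close>

lemma isolated_clique_flip_iff:
  assumes "\<not> i \<le> card (j \<inter> W)"
  shows "isolated_clique v k i W (flip x {j}) \<longleftrightarrow> isolated_clique v k i W x"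
  using assms unfolding isolated_clique_def mem_flip_singleton by blast

text \<open>Each sensitive edge is encoded by an \<open>i\<close>-subset of the witness it creates.
  Distinct witnesses cannot share an \<open>i\<close>-subset, and a witness determines its
  edge.\<close>

lemma card_zero_sensitive_le:
  assumes i: "i < k" and k: "2 \<le> k" and x: "\<not> has_isolated_clique v k i x"
  shows "card {j \<in> coords v k. has_isolated_clique v k i (flip x {j})} \<le> v ^ i" (is "card ?J \<le> _")
proof -
  obtain w where w: "\<And>j. j \<in> ?J \<Longrightarrow> w j \<in> coords v (k + 3) \<and> isolated_clique v k i (w j) (flip x {j})"
    using bchoice[of ?J "\<lambda>j W. W \<in> coords v (k + 3) \<and> isolated_clique v k i W (flip x {j})"]
    unfolding has_isolated_clique_def by blast
  have meets: "i \<le> card (j \<inter> w j)" if "j \<in> ?J" for j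
    using w[OF that] x isolated_clique_flip_iff unfolding has_isolated_clique_def by blast
  have inj_w: "j = l" if jl: "j \<in> ?J" "l \<in> ?J" "w j = w l" for j l
  proof -
    \<comment> \<open>The common witness inspects \<open>j\<close> and so prescribes the same status
      of \<open>j\<close> in both flips; the first flip toggles \<open>j\<close>, so the second must
      as well.\<close>
    have "j \<in> flip x {j} \<longleftrightarrow> j \<in> flip x {l}"
      using w[OF jl(1)] w[OF jl(2)] meets[OF jl(1)] jl unfolding isolated_clique_def by auto
    then show ?thesis
      unfolding mem_flip_singleton by blast
  qed
  have "\<exists>I. I \<subseteq> w j \<and> card I = i" if "j \<in> ?J" for j
  proof -
    have "i \<le> card (w j)"
      using w[OF that] i unfolding coords_def by simp
    then show ?thesis
      by (blast dest: exists_subset_card)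
  qed
  then obtain I where I: "\<And>j. j \<in> ?J \<Longrightarrow> I j \<subseteq> w j \<and> card (I j) = i"
    using bchoice[of ?J "\<lambda>j I. I \<subseteq> w j \<and> card I = i"] by blast
  have "inj_on I ?J"
  proof (rule inj_onI, rule inj_w)
    fix j l assume jl: "j \<in> ?J" "l \<in> ?J" "I j = I l"
    have "finite (w j \<inter> w l)"
      using w[OF jl(1)] finite_coordsD by blast
    then have "i \<le> card (w j \<inter> w l)"
      using I[OF jl(1)] I[OF jl(2)] jl(3) by (metis Int_greatest card_mono)
    then show "w j = w l"
      using flip_witnesses_overlap[of "w j" v k i x j "w l" l] w[OF jl(1)] w[OF jl(2)] i k by auto
  qed
  moreover have "I ` ?J \<subseteq> coords v i"
    using I w unfolding coords_def by blast
  ultimately have "card ?J \<le> card (coords v i)"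
    by (intro card_inj_on_le) auto
  then show ?thesis
    using binomial_le_pow_nat[of v i] by (simp add: card_coords)
qed

lemma sens_has_isolated_clique_le:
  assumes i: "1 \<le> i" "2 * i \<le> k"
  shows "sens v k (has_isolated_clique v k i) \<le> ((k + 3) choose i) * v ^ (k - i)"
proof (rule sens_leI)
  fix x
  let ?f = "has_isolated_clique v k i"
  let ?J = "{j \<in> coords v k. ?f (flip x {j}) \<noteq> ?f x}"
  show "card ?J \<le> ((k + 3) choose i) * v ^ (k - i)"
  proof (cases "?f x")
    case True
    then obtain W where W: "W \<in> coords v (k + 3)" "isolated_clique v k i W x"
      unfolding has_isolated_clique_def by blast
    then have "?J \<subseteq> {j \<in> coords v k. i \<le> card (j \<inter> W)}"
      using True isolated_clique_flip_iff unfolding has_isolated_clique_def by blast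
    then have "card ?J \<le> card {j \<in> coords v k. i \<le> card (j \<inter> W)}"
      by (intro card_mono) auto
    also have "\<dots> \<le> ((k + 3) choose i) * v ^ (k - i)"
      using card_meeting_le[OF W(1)] i by simp
    finally show ?thesis .
  next
    case False
    show ?thesis
    \<comment> \<open>Comparing powers of \<open>v\<close> by their exponents below needs
      \<open>v\<close> positive.\<close>
    proof (cases "v = 0")
      case True
      then have "coords v k = {}"
        using i unfolding coords_def by auto
      then show ?thesis by simp
    next
      case v: False
      have "card ?J \<le> v ^ i"
        using card_zero_sensitive_le[of i k v x] False i by simp
      \<comment> \<open>Here \<open>2 * i \<le> k\<close> gives
        \<open>i \<le> k - i\<close>.\<close>
      also have "\<dots> \<le> v ^ (k - i)"
        using v i by (intro power_increasing) auto
      also have "\<dots> \<le> ((k + 3) choose i) * v ^ (k - i)"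
        using i by (simp add: Suc_le_eq)
      finally show ?thesis .
    qed
  qed
qed

section \<open>Lower bound on the sensitivity\<close>

lemma has_isolated_clique_clique:
  "W \<in> coords v (k + 3) \<Longrightarrow> has_isolated_clique v k i (clique k W)"
  unfolding has_isolated_clique_def isolated_clique_def
  by (intro bexI[of _ W]) (auto simp: clique_def coords_def)

text \<open>The edge \<open>j\<close> spoils \<open>W\<close> itself. Any other witness has a vertex
  \<open>u\<close> outside \<open>W\<close> and contains at least two edges through
  \<open>u\<close>, whereas \<open>j\<close> is the only edge that can contain
  \<open>u\<close>.\<close>

lemma sensitive_pendant_edge:
  assumes W: "W \<in> coords v (k + 3)" and k: "2 \<le> k"
    and j: "j \<in> coords v k" "i \<le> card (j \<inter> W)" "\<not> j \<subseteq> W" and i: "i \<le> k"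
  shows "\<not> has_isolated_clique v k i (flip (clique k W) {j})"
proof
  assume "has_isolated_clique v k i (flip (clique k W) {j})"
  then obtain W' where W': "W' \<in> coords v (k + 3)"
    "isolated_clique v k i W' (flip (clique k W) {j})"
    unfolding has_isolated_clique_def by blast
  have "W' \<noteq> W"
    using W' j unfolding isolated_clique_def mem_flip_singleton clique_def by auto
  then have "\<not> W' \<subseteq> W"
    using W W' card_subset_eq[OF finite_coordsD[OF W], of W'] unfolding coords_def by auto
  then obtain u where u: "u \<in> W'" "u \<notin> W"
    by blast
  have uniq: "e = j" if "e \<subseteq> W'" "card e = k" "u \<in> e" for e
  proof -
    have "e \<in> coords v k" "e \<inter> W' = e"
      using that W' unfolding coords_def by auto
    then have "e \<in> flip (clique k W) {j}"
      using that W' i unfolding isolated_clique_def by auto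
    then show ?thesis
      using that u unfolding mem_flip_singleton clique_def by blast
  qed
  have fin: "finite W'" "card W' = k + 3"
    using W'(1) finite_coordsD[OF W'(1)] unfolding coords_def by auto
  have "\<exists>e. {u} \<subseteq> e \<and> e \<subseteq> W' \<and> card e = k"
    using u fin k by (intro exists_subset_between) auto
  then obtain e where e: "{u} \<subseteq> e" "e \<subseteq> W'" "card e = k"
    by blast
  have "e \<noteq> {u}"
    using e(3) k by auto
  then obtain d where d: "d \<in> e" "d \<noteq> u"
    using e(1) by blast
  \<comment> \<open>Omitting a vertex \<open>d\<close> of \<open>e\<close> forces a second edge
    through \<open>u\<close>, different from \<open>e\<close>.\<close>
  have "\<exists>e'. {u} \<subseteq> e' \<and> e' \<subseteq> W' - {d} \<and> card e' = k"
    using u(1) fin k d(2) by (intro exists_subset_between) (auto simp: card_Diff_singleton_if)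
  then obtain e' where e': "{u} \<subseteq> e'" "e' \<subseteq> W' - {d}" "card e' = k"
    by blast
  have "e = j" "e' = j"
    using uniq e e' by auto
  then show False
    using d e' by blast
qed

text \<open>For the clique on the first \<open>k + 3\<close> vertices, every edge formed by
  \<open>{..<i}\<close> and \<open>k - i\<close> vertices outside the clique is sensitive.\<close>

lemma sens_has_isolated_clique_ge:
  assumes i: "1 \<le> i" "i < k" and v: "k + 3 \<le> v"
  shows "(v - (k + 3)) choose (k - i) \<le> sens v k (has_isolated_clique v k i)"
proof -
  let ?f = "has_isolated_clique v k i"
  define W where "W = {..<k + 3}"
  define R where "R = {r. r \<subseteq> {k + 3..<v} \<and> card r = k - i}"
  have W: "W \<in> coords v (k + 3)"
    using v unfolding W_def coords_def by auto
  have x: "clique k W \<in> hgraphs v k"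
    using clique_subset_coords[OF W] unfolding hgraphs_def by blast
  have fx: "?f (clique k W)"
    using W by (rule has_isolated_clique_clique)
  have "(\<lambda>r. {..<i} \<union> r) ` R \<subseteq> {j \<in> coords v k. ?f (flip (clique k W) {j}) \<noteq> ?f (clique k W)}"
  proof
    fix j assume "j \<in> (\<lambda>r. {..<i} \<union> r) ` R"
    then obtain r where r: "r \<subseteq> {k + 3..<v}" "card r = k - i" "j = {..<i} \<union> r"
      unfolding R_def by blast
    have finr: "finite r"
      using r finite_subset by blast
    have "card j = k"
      using r finr i by (subst r(3), subst card_Un_disjoint) auto
    then have j: "j \<in> coords v k"
      using r i v unfolding coords_def by auto
    have "{..<i} \<subseteq> j \<inter> W"
      using r i unfolding W_def by auto
    then have "i \<le> card (j \<inter> W)"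
      using card_mono[of "j \<inter> W" "{..<i}"] unfolding W_def by simp
    moreover have "r \<noteq> {}"
      using r i by auto
    then have "\<not> j \<subseteq> W"
      using r unfolding W_def by fastforce
    ultimately have "\<not> ?f (flip (clique k W) {j})"
      using sensitive_pendant_edge[OF W _ j] i by simp
    then show "j \<in> {j \<in> coords v k. ?f (flip (clique k W) {j}) \<noteq> ?f (clique k W)}"
      using j fx by blast
  qed
  moreover have "inj_on (\<lambda>r. {..<i} \<union> r) R"
  proof (rule inj_onI)
    fix r s assume rs: "r \<in> R" "s \<in> R" "{..<i} \<union> r = {..<i} \<union> s"
    have "{..<i} \<inter> r = {}" "{..<i} \<inter> s = {}"
      using rs i unfolding R_def by fastforce+
    then show "r = s"
      using rs(3) by blast
  qed
  ultimately have "card R \<le> card {j \<in> coords v k. ?f (flip (clique k W) {j}) \<noteq> ?f (clique k W)}"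
    by (intro card_inj_on_le) auto
  also have "\<dots> \<le> sens v k ?f"
    by (rule card_le_sens[OF x])
  finally show ?thesis
    unfolding R_def using n_subsets[of "{k + 3..<v}" "k - i"] by simp
qed

section \<open>Block sensitivity\<close>

text \<open>Take an inclusion-maximal packing. Every \<open>m\<close>-set shares \<open>k\<close>
  vertices with some member, so it is a \<open>k\<close>-subset of a member together with
  \<open>m - k\<close> other vertices; counting these pairs gives the bound.\<close>

lemma packing_exists:
  assumes km: "k \<le> m"
  obtains P where "P \<subseteq> coords v m"
    "\<And>W W'. W \<in> P \<Longrightarrow> W' \<in> P \<Longrightarrow> W \<noteq> W' \<Longrightarrow> card (W \<inter> W') < k"
    "v choose m \<le> card P * (m choose k) * (v choose (m - k))"
proof -
  define packing where "packing = {P. P \<subseteq> coords v m \<and>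
    (\<forall>W\<in>P. \<forall>W'\<in>P. W \<noteq> W' \<longrightarrow> card (W \<inter> W') < k)}"
  have "packing \<subseteq> Pow (coords v m)"
    unfolding packing_def by blast
  then have "finite packing"
    by (rule finite_subset) simp
  moreover have "{} \<in> packing"
    unfolding packing_def by simp
  ultimately obtain P where P: "P \<in> packing" and max: "\<And>Q. Q \<in> packing \<Longrightarrow> P \<subseteq> Q \<Longrightarrow> P = Q"
    using finite_has_maximal[of packing] by blast
  have PD: "P \<subseteq> coords v m" "\<And>W W'. W \<in> P \<Longrightarrow> W' \<in> P \<Longrightarrow> W \<noteq> W' \<Longrightarrow> card (W \<inter> W') < k"
    using P unfolding packing_def by auto
  have finP: "finite P"
    using PD(1) finite_coords finite_subset by blast
  have near: "\<exists>W\<in>P. k \<le> card (M \<inter> W)" if M: "M \<in> coords v m" for M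
  proof (rule ccontr)
    assume far: "\<not> (\<exists>W\<in>P. k \<le> card (M \<inter> W))"
    then have "insert M P \<in> packing"
      using M P unfolding packing_def by (auto simp: Int_commute[of _ M] not_le)
    \<comment> \<open>Maximality puts \<open>M\<close> into \<open>P\<close>, yet \<open>M\<close>
      meets itself in \<open>m \<ge> k\<close> vertices.\<close>
    then have "M \<in> P"
      using max by blast
    moreover have "k \<le> card (M \<inter> M)"
      using M km unfolding coords_def by simp
    ultimately show False
      using far by blast
  qed
  let ?D = "(\<Union>W\<in>P. clique k W) \<times> coords v (m - k)"
  have fin: "finite (\<Union>W\<in>P. clique k W)"
    using PD(1) clique_subset_coords by (intro finite_subset[OF _ finite_coords[of v k]]) blast
  have "coords v m \<subseteq> (\<lambda>(a, b). a \<union> b) ` ?D"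
  proof
    fix M assume M: "M \<in> coords v m"
    obtain W where W: "W \<in> P" "k \<le> card (M \<inter> W)"
      using near[OF M] by blast
    then obtain a where a: "a \<subseteq> M \<inter> W" "card a = k"
      by (blast dest: exists_subset_card)
    have "card (M - a) = m - k"
      using a M finite_coordsD[OF M] finite_subset[of a M] unfolding coords_def
      by (subst card_Diff_subset) auto
    then have "(a, M - a) \<in> ?D" "M = a \<union> (M - a)"
      using a M W unfolding clique_def coords_def by auto
    then show "M \<in> (\<lambda>(a, b). a \<union> b) ` ?D"
      by (auto intro: image_eqI[of _ _ "(a, M - a)"])
  qed
  then have "card (coords v m) \<le> card ?D"
    using fin by (intro surj_card_le) auto
  also have "\<dots> = card (\<Union>W\<in>P. clique k W) * (v choose (m - k))"
    by (simp add: card_cartesian_product card_coords)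
  also have "card (\<Union>W\<in>P. clique k W) \<le> (\<Sum>W\<in>P. card (clique k W))"
    using finP by (rule card_UN_le)
  also have "\<dots> = card P * (m choose k)"
  proof -
    have "card (clique k W) = m choose k" if "W \<in> P" for W
      using that PD(1) n_subsets[of W k] finite_coordsD[of W v m]
      unfolding clique_def coords_def by auto
    then show ?thesis
      by simp
  qed
  finally show ?thesis
    using that[OF PD] by (simp add: card_coords)
qed

text \<open>Members of the packing share no \<open>k\<close>-set, so their cliques are disjoint
  blocks; being nonempty, they are also distinct, and there are \<open>card P\<close> of
  them.\<close>

lemma bsens_has_isolated_clique_ge:
  assumes i: "i \<le> k"
  shows "v choose (k + 3) \<le>
    bsens v k (has_isolated_clique v k i) * ((k + 3) choose k) * (v choose 3)"
proof -
  let ?f = "has_isolated_clique v k i"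
  obtain P where P: "P \<subseteq> coords v (k + 3)"
    "\<And>W W'. W \<in> P \<Longrightarrow> W' \<in> P \<Longrightarrow> W \<noteq> W' \<Longrightarrow> card (W \<inter> W') < k"
    "v choose (k + 3) \<le> card P * ((k + 3) choose k) * (v choose (k + 3 - k))"
    by (rule packing_exists[OF le_add1]) (rule that)
  have ne: "clique k W \<noteq> {}" if "W \<in> coords v (k + 3)" for W
    using that exists_subset_card[of k W] unfolding clique_def coords_def by auto
  have disj: "clique k W \<inter> clique k W' = {}" if W: "W \<in> P" "W' \<in> P" "W \<noteq> W'" for W W'
  proof (rule ccontr)
    assume "clique k W \<inter> clique k W' \<noteq> {}"
    then obtain e where "e \<subseteq> W \<inter> W'" "card e = k"
      unfolding clique_def by blast
    moreover have "finite (W \<inter> W')"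
      using W P(1) finite_coordsD by blast
    ultimately show False
      using P(2)[OF W] card_mono[of "W \<inter> W'" e] by simp
  qed
  have inj: "inj_on (clique k) P"
  proof (rule inj_onI)
    fix W W' assume W: "W \<in> P" "W' \<in> P" "clique k W = clique k W'"
    moreover have "clique k W \<noteq> {}"
      using W(1) P(1) by (intro ne) blast
    ultimately show "W = W'"
      using disj[of W W'] by auto
  qed
  \<comment> \<open>A witness has \<open>k + 3\<close> vertices and hence requires at least one
    edge.\<close>
  have empty: "\<not> ?f {}"
  proof
    assume "?f {}"
    then obtain W where W: "W \<in> coords v (k + 3)" "isolated_clique v k i W {}"
      unfolding has_isolated_clique_def by blast
    obtain e where e: "e \<in> clique k W"
      using ne[OF W(1)] by blast
    then have "e \<in> coords v k" "e \<inter> W = e" "e \<subseteq> W" "card e = k"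
      using clique_subset_coords[OF W(1)] unfolding clique_def by auto
    then show False
      using W(2) i unfolding isolated_clique_def by auto
  qed
  have full: "?f (flip {} (clique k W))" if "W \<in> P" for W
    using has_isolated_clique_clique that P(1) unfolding flip_def by auto
  have "sensitive_blocks v k ?f {} (clique k ` P)"
    unfolding sensitive_blocks_def
  proof (intro conjI)
    show "{} \<in> hgraphs v k"
      unfolding hgraphs_def by simp
    show "clique k ` P \<subseteq> Pow (coords v k)"
      using P(1) clique_subset_coords by blast
    show "\<forall>B\<in>clique k ` P. \<forall>C\<in>clique k ` P. B \<noteq> C \<longrightarrow> B \<inter> C = {}"
      using disj by blast
    show "\<forall>B\<in>clique k ` P. ?f (flip {} B) \<noteq> ?f {}"
      using empty full by simp
  qed
  then have "card (clique k ` P) \<le> bsens v k ?f"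
    by (rule card_le_bsens)
  then have "card P \<le> bsens v k ?f"
    using inj by (simp add: card_image)
  then have "card P * ((k + 3) choose k) * (v choose 3) \<le>
      bsens v k ?f * ((k + 3) choose k) * (v choose 3)"
    by (intro mult_right_mono) auto
  then show ?thesis
    using P(3) unfolding add_diff_cancel_left' by (rule order_trans[rotated])
qed

section \<open>Asymptotics\<close>

lemma bigthetaI_nat:
  fixes g :: "nat \<Rightarrow> nat"
  assumes "\<And>v. g v \<le> C * v ^ d"
    and "0 < c" "\<And>v. v \<ge> N \<Longrightarrow> c * real v ^ d \<le> real (g v)"
  shows "(\<lambda>v. real (g v)) \<in> \<Theta>(\<lambda>v. real v ^ d)"
proof (rule bigthetaI)
  have "real (g v) \<le> real C * real v ^ d" for v
    using of_nat_mono[OF assms(1)[of v], where ?'a = real] by simp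
  then show "(\<lambda>v. real (g v)) \<in> O(\<lambda>v. real v ^ d)"
    by (intro bigoI[of _ "real C"]) simp
  show "(\<lambda>v. real (g v)) \<in> \<Omega>(\<lambda>v. real v ^ d)"
    using assms(2,3) by (intro landau_omega.bigI[of c] eventually_sequentiallyI[of N]) auto
qed

lemma sens_bigtheta:
  assumes i: "1 \<le> i" "2 * i \<le> k"
  shows "(\<lambda>v. real (sens v k (has_isolated_clique v k i))) \<in> \<Theta>(\<lambda>v. real v ^ (k - i))"
proof (rule bigthetaI_nat)
  show "sens v k (has_isolated_clique v k i) \<le> ((k + 3) choose i) * v ^ (k - i)" for v
    using i by (rule sens_has_isolated_clique_le)
  \<comment> \<open>The constant comes from bounding \<open>(v - (k + 3)) choose (k - i)\<close>
    below by the power of \<open>(v / 2) / (k - i)\<close>.\<close>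
  show "0 < (1 / (2 * real (k - i))) ^ (k - i)"
    using i by simp
  \<comment> \<open>This threshold ensures that removing \<open>k + 3\<close> vertices leaves at
    least half of them, and at least \<open>k - i\<close>.\<close>
  fix v assume v: "3 * (k + 3) \<le> v"
  have "(real v / 2) / real (k - i) \<le> real (v - (k + 3)) / real (k - i)"
    using v by (intro divide_right_mono) auto
  then have "real v / (2 * real (k - i)) \<le> real (v - (k + 3)) / real (k - i)"
    by simp
  then have "(real v / (2 * real (k - i))) ^ (k - i) \<le> (real (v - (k + 3)) / real (k - i)) ^ (k - i)"
    by (intro power_mono) auto
  also have "\<dots> \<le> real ((v - (k + 3)) choose (k - i))"
    using v by (intro binomial_ge_n_over_k_pow_k) simp
  also have "\<dots> \<le> real (sens v k (has_isolated_clique v k i))"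
    using sens_has_isolated_clique_ge[of i k v] i v by simp
  finally show "(1 / (2 * real (k - i))) ^ (k - i) * real v ^ (k - i)
      \<le> real (sens v k (has_isolated_clique v k i))"
    by (simp add: power_divide)
qed

lemma bsens_bigtheta:
  assumes i: "i \<le> k"
  shows "(\<lambda>v. real (bsens v k (has_isolated_clique v k i))) \<in> \<Theta>(\<lambda>v. real v ^ k)"
proof (rule bigthetaI_nat)
  show "bsens v k (has_isolated_clique v k i) \<le> 1 * v ^ k" for v
    using order_trans[OF bsens_le binomial_le_pow_nat] by simp
  \<comment> \<open>\<open>D\<close> collects the number of edges per clique and the denominator in
    \<open>(v / (k + 3)) ^ (k + 3) \<le> v choose (k + 3)\<close>.\<close>
  define D where "D = real ((k + 3) choose k) * real (k + 3) ^ (k + 3)"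
  have D: "0 < D"
    unfolding D_def by simp
  then show "0 < 1 / D"
    by simp
  fix v assume v: "k + 3 \<le> v"
  let ?b = "real (bsens v k (has_isolated_clique v k i))"
  have "(real v / real (k + 3)) ^ (k + 3) \<le> real (v choose (k + 3))"
    using v by (rule binomial_ge_n_over_k_pow_k)
  also have "\<dots> \<le> ?b * real ((k + 3) choose k) * real (v choose 3)"
    using of_nat_mono[OF bsens_has_isolated_clique_ge[OF i, of v], where ?'a = real] by simp
  also have "\<dots> \<le> ?b * real ((k + 3) choose k) * real v ^ 3"
    using of_nat_mono[OF binomial_le_pow_nat[of v 3], where ?'a = real]
    by (intro mult_left_mono) auto
  \<comment> \<open>The exponent is split so that the factor \<open>v ^ 3\<close> bounding
    \<open>v choose 3\<close> cancels.\<close>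
  finally have "real v ^ k * real v ^ 3 \<le> (?b * D) * real v ^ 3"
    unfolding D_def by (simp add: power_divide power_add divide_le_eq mult_ac)
  then have "real v ^ k \<le> ?b * D"
    using v by (simp add: mult_le_cancel_right)
  then show "1 / D * real v ^ k \<le> ?b"
    using D by (simp add: field_simps)
qed

theorem theorem4p3:
  fixes k i :: nat
  assumes "1 \<le> i" and "2 * i \<le> k"
  shows "\<exists>f :: nat \<Rightarrow> nat set set \<Rightarrow> bool.
           (\<forall>v. is_property v k (f v)) \<and>
           (\<lambda>v. real (sens v k (f v))) \<in> \<Theta>(\<lambda>v. real v ^ (k - i)) \<and>
           (\<lambda>v. real (bsens v k (f v))) \<in> \<Theta>(\<lambda>v. real v ^ k)"
  using is_property_has_isolated_clique sens_bigtheta[OF assms] bsens_bigtheta[of i k] assms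
  by (intro exI[of _ "\<lambda>v. has_isolated_clique v k i"]) auto

end
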